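(* Let $L$ be a real number, let $(a_n)_{n\ge 0}$ be the sequence of sums of consecutive generalized Catalan numbers $a_n=c(n;L)+c(n+1;L)$ (with $a_0=L+1$), and for $n\ge 1$ let $h_n=\det\bigl(a_{i+j-2}\bigr)_{1\le i,j\le n}$ be its Hankel transform. Then for every integer $n\ge 1$, $$ h_n= \frac{L^{(n^2-n)/2}}{2^{n+1}\sqrt{L^2+4}}\left\{\bigl(\sqrt{L^2+4}+L\bigr)\bigl(\sqrt{L^2+4}+L+2\bigr)^{n}+\bigl(\sqrt{L^2+4}-L\bigr)\bigl(L+2-\sqrt{L^2+4}\bigr)^{n}\right\}. $$
   Context: For a parameter $L$ and integers $0\le k\le n$, put $$T(n,k;L)=\sum_{j=0}^{n-k}\binom{k}{j}\binom{n-k}{j}L^j$$ (the generalized Pascal triangle associated to the sequence $n\mapsto L^n$). The generalized Catalan numbers with parameter $L$ are $$c(n;L)=T(2n,n;L)-T(2n,n-1;L)\quad (n\ge 1),\qquad c(0;L)=1.$$ The sequence considered is $a_0=L+1$ and $a_n=a_n(L)=c(n;L)+c(n+1;L)$ for $n\ge 1$. The Hankel transform of $(a_n)_{n\ge0}$ is the sequence of $n\times n$ Hankel determinants $h_n=\det(a_{i+j-2})_{1\le i,j\le n}$, so that $h_1=a_0$. The convention $0^0=1$ is used. *)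

theory Defs
  imports Complex_Main "Jordan_Normal_Form.Determinant"
begin

(* Meaningful for k \<le> n only; for k > n the truncated difference n - k is not the intended bound. *)
definition gen_pascal :: "nat \<Rightarrow> nat \<Rightarrow> real \<Rightarrow> real" where
  "gen_pascal n k L = (\<Sum>j=0..n - k. real (k choose j) * real ((n - k) choose j) * L ^ j)"

definition gen_catalan :: "nat \<Rightarrow> real \<Rightarrow> real" where
  "gen_catalan n L =
     (if n = 0 then 1 else gen_pascal (2 * n) n L - gen_pascal (2 * n) (n - 1) L)"

definition catalan_sum :: "real \<Rightarrow> nat \<Rightarrow> real" where
  "catalan_sum L n =
     (if n = 0 then L + 1 else gen_catalan n L + gen_catalan (n + 1) L)"

(* Matrix indices start at 0 here, so entry (i, j) is a (i + j) rather than a (i + j - 2). *)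
definition hankel_transform :: "(nat \<Rightarrow> real) \<Rightarrow> nat \<Rightarrow> real" where
  "hankel_transform a n = det (mat n n (\<lambda>(i, j). a (i + j)))"

end

theory Submission
  imports Defs
begin

text \<open>
  The generalized Catalan numbers are the moments of an explicit tridiagonal (Jacobi) operator \<open>J\<close>
  on sequences, with diagonal \<open>L, L + 1, L + 1, \<dots>\<close>, subdiagonal \<open>1\<close> and
  superdiagonal \<open>L\<close>: the number \<open>c(n; L)\<close> is entry \<open>0\<close> of \<open>J\<close> applied \<open>n\<close> times to the
  unit sequence (\<open>gen_catalan_eq_moment\<close>).

  Let row \<open>n\<close> of the array \<open>A\<close> be \<open>J\<close> applied \<open>n\<close> times to the unit sequence. This array is lower
  unitriangular. The operator \<open>J\<close> is symmetric for the bilinear form with weights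
  \<open>w k = L ^ k\<close>, so steps may be moved from one row to the other, and the moments satisfy
  \<open>c (i + j) = (\<Sum>k. w k * A i k * A j k)\<close> (\<open>stieltjes_gram\<close>). Adding the moment of the next index
  replaces row \<open>j\<close> by \<open>(1 + J)\<close> applied to row \<open>j\<close>. Hence the Hankel matrix of
  \<open>c n + c (n + 1)\<close> factors as \<open>A\<close>, times the diagonal of the weights, times the truncation
  of \<open>1 + J\<close>, times the transpose of \<open>A\<close> (\<open>det_hankel_shifted_moments\<close>).

  Only two factors contribute to the determinant. The weights give
  \<open>L ^ (0 + 1 + \<dots> + (n - 1))\<close>. The truncations of \<open>1 + J\<close> have determinants \<open>d n\<close> with
  \<open>d 0 = 1\<close>, \<open>d 1 = L + 1\<close> and \<open>d (n + 2) = (L + 2) * d (n + 1) - L * d n\<close>. The characteristic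
  roots of this recurrence are \<open>(L + 2 \<plusminus> sqrt (L\<^sup>2 + 4)) / 2\<close>, which yields the closed form.
\<close>

section \<open>Stieltjes arrays and their moments\<close>

definition jacobi :: "(nat \<Rightarrow> 'a) \<Rightarrow> (nat \<Rightarrow> 'a) \<Rightarrow> (nat \<Rightarrow> 'a) \<Rightarrow> nat \<Rightarrow> 'a :: comm_ring_1" where
  "jacobi b lam f k = (case k of 0 \<Rightarrow> 0 | Suc l \<Rightarrow> f l) + b k * f k + lam k * f (Suc k)"

fun stieltjes :: "(nat \<Rightarrow> 'a) \<Rightarrow> (nat \<Rightarrow> 'a) \<Rightarrow> nat \<Rightarrow> nat \<Rightarrow> 'a :: comm_ring_1" where
  "stieltjes b lam 0 = (\<lambda>k. if k = 0 then 1 else 0)"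
| "stieltjes b lam (Suc n) = jacobi b lam (stieltjes b lam n)"

definition jacobi_weight :: "(nat \<Rightarrow> 'a) \<Rightarrow> nat \<Rightarrow> 'a :: comm_ring_1" where
  "jacobi_weight lam k = (\<Prod>l<k. lam l)"

lemma stieltjes_above_diagonal: "n < k \<Longrightarrow> stieltjes b lam n k = 0"
  by (induction n arbitrary: k) (auto simp: jacobi_def split: nat.splits)

lemma stieltjes_diagonal: "stieltjes b lam n n = 1"
  by (induction n) (auto simp: jacobi_def stieltjes_above_diagonal split: nat.splits)

text \<open>
  This is the discrete Green formula: \<open>J\<close> is symmetric for the weighted form because
  \<open>w (k + 1) = w k * lam k\<close> makes the off-diagonal terms telescope; only a boundary term at the
  cut-off survives, and it vanishes for finitely supported sequences.
\<close>

lemma jacobi_green: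
  fixes f g :: "nat \<Rightarrow> 'a :: comm_ring_1"
  shows "(\<Sum>k\<le>N. jacobi_weight lam k * jacobi b lam f k * g k)
       - (\<Sum>k\<le>N. jacobi_weight lam k * f k * jacobi b lam g k)
       = jacobi_weight lam (Suc N) * (f (Suc N) * g N - f N * g (Suc N))"
proof (induction N)
  case 0
  show ?case by (simp add: jacobi_def jacobi_weight_def algebra_simps)
next
  case (Suc N)
  have "jacobi_weight lam (Suc (Suc N)) = jacobi_weight lam (Suc N) * lam (Suc N)"
    by (simp add: jacobi_weight_def)
  with Suc show ?case by (simp add: jacobi_def algebra_simps)
qed

text \<open>
  By symmetry of \<open>J\<close> one application can be moved from row \<open>i + 1\<close> to row \<open>j\<close>, so the weighted
  product of two rows depends on \<open>i + j\<close> alone. Truncation at \<open>N \<ge> i\<close> is exact because row \<open>i\<close>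
  vanishes beyond \<open>i\<close>.
\<close>

lemma stieltjes_gram:
  "i \<le> N \<Longrightarrow> (\<Sum>k\<le>N. jacobi_weight lam k * stieltjes b lam i k * stieltjes b lam j k)
     = stieltjes b lam (i + j) 0"
proof (induction i arbitrary: j N)
  case 0
  have "(\<Sum>k\<le>N. jacobi_weight lam k * stieltjes b lam 0 k * stieltjes b lam j k)
      = (\<Sum>k\<in>{0}. jacobi_weight lam k * stieltjes b lam 0 k * stieltjes b lam j k)"
    by (rule sum.mono_neutral_right) auto
  then show ?case by (simp add: jacobi_weight_def)
next
  case (Suc i)
  \<comment> \<open>Large enough for both rows to vanish at \<open>Suc ?M\<close>, which removes the boundary term.\<close>
  let ?M = "Suc N + Suc j"
  have ext: "(\<Sum>k\<le>N. jacobi_weight lam k * stieltjes b lam i' k * stieltjes b lam j' k)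
      = (\<Sum>k\<le>?M. jacobi_weight lam k * stieltjes b lam i' k * stieltjes b lam j' k)"
    if "i' \<le> N" for i' j'
    using that by (intro sum.mono_neutral_left) (auto simp: stieltjes_above_diagonal)
  have "(\<Sum>k\<le>?M. jacobi_weight lam k * stieltjes b lam (Suc i) k * stieltjes b lam j k)
      = (\<Sum>k\<le>?M. jacobi_weight lam k * stieltjes b lam i k * stieltjes b lam (Suc j) k)"
    using jacobi_green[of lam b "stieltjes b lam i" "stieltjes b lam j" ?M] Suc.prems
    by (simp add: stieltjes_above_diagonal)
  with Suc.prems Suc.IH[of N "Suc j"] show ?case
    by (simp only: ext Suc_leD add_Suc_shift)
qed

section \<open>Hankel determinants of shifted moments\<close>

text \<open>The \<open>n \<times> n\<close> truncation of \<open>t + J\<close>.\<close>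

definition jacobi_mat :: "'a \<Rightarrow> (nat \<Rightarrow> 'a) \<Rightarrow> (nat \<Rightarrow> 'a) \<Rightarrow> nat \<Rightarrow> 'a :: comm_ring_1 mat" where
  "jacobi_mat t b lam n = mat n n (\<lambda>(k, l).
     (if k = Suc l then 1 else 0) + (if l = k then t + b k else 0) + (if l = Suc k then lam k else 0))"

text \<open>
  Truncation loses nothing on sequences supported below \<open>n\<close>; this is what keeps the factorization
  of the finite Hankel matrix exact.
\<close>

lemma jacobi_mat_mult:
  assumes "k < n" and "\<And>l. n \<le> l \<Longrightarrow> f l = 0"
  shows "(\<Sum>l<n. jacobi_mat t b lam n $$ (k, l) * f l) = t * f k + jacobi b lam f k"
proof -
  have "(\<Sum>l<n. jacobi_mat t b lam n $$ (k, l) * f l)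
      = (\<Sum>l<n. (if l = k then (t + b k) * f l else 0))
      + (\<Sum>l<n. (if l = Suc k then lam k * f l else 0))
      + (\<Sum>l<n. (if k = Suc l then f l else 0))"
    unfolding sum.distrib[symmetric] using assms(1)
    by (intro sum.cong) (auto simp: jacobi_mat_def)
  also have "(\<Sum>l<n. (if l = k then (t + b k) * f l else 0)) = (t + b k) * f k"
    using assms(1) by (simp add: sum.delta)
  also have "(\<Sum>l<n. (if l = Suc k then lam k * f l else 0)) = lam k * f (Suc k)"
    using assms(2)[of "Suc k"] by (auto simp: sum.delta)
  also have "(\<Sum>l<n. (if k = Suc l then f l else 0)) = (case k of 0 \<Rightarrow> 0 | Suc l \<Rightarrow> f l)"
    using assms(1) by (cases k) (auto simp: sum.delta')
  finally show ?thesis by (simp add: jacobi_def algebra_simps)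
qed

lemma det_last_row_two_entries:
  fixes M :: "'a :: comm_ring_1 mat"
  assumes M: "M \<in> carrier_mat (Suc (Suc n)) (Suc (Suc n))"
    and zero: "\<And>j. j < n \<Longrightarrow> M $$ (Suc n, j) = 0"
  shows "det M = M $$ (Suc n, Suc n) * det (mat_delete M (Suc n) (Suc n))
     - M $$ (Suc n, n) * det (mat_delete M (Suc n) n)"
proof -
  have "det M = (\<Sum>j<Suc (Suc n). M $$ (Suc n, j) * cofactor M (Suc n) j)"
    using laplace_expansion_row[OF M, of "Suc n"] by simp
  also have "\<dots> = M $$ (Suc n, n) * cofactor M (Suc n) n
      + M $$ (Suc n, Suc n) * cofactor M (Suc n) (Suc n)"
    using zero by simp
  finally show ?thesis by (simp add: cofactor_def)
qed

text \<open>
  This is the continuant recurrence, from two Laplace expansions: along the last row, then along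
  the last column of the second minor, whose only nonzero entry is \<open>lam n\<close>.
\<close>

lemma det_jacobi_mat_rec:
  "det (jacobi_mat t b lam (Suc (Suc n)))
     = (t + b (Suc n)) * det (jacobi_mat t b lam (Suc n)) - lam n * det (jacobi_mat t b lam n)"
proof -
  let ?M = "jacobi_mat t b lam (Suc (Suc n))"
  let ?B = "mat_delete ?M (Suc n) n"
  have M: "?M \<in> carrier_mat (Suc (Suc n)) (Suc (Suc n))" by (simp add: jacobi_mat_def)
  have B: "?B \<in> carrier_mat (Suc n) (Suc n)" by (simp add: jacobi_mat_def mat_delete_def)
  have d1: "mat_delete ?M (Suc n) (Suc n) = jacobi_mat t b lam (Suc n)"
    by (rule eq_matI) (auto simp: jacobi_mat_def mat_delete_def)
  have d2: "mat_delete ?B n n = jacobi_mat t b lam n"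
    by (rule eq_matI) (auto simp: jacobi_mat_def mat_delete_def)
  have "det ?B = (\<Sum>i<Suc n. ?B $$ (i, n) * cofactor ?B i n)"
    using laplace_expansion_column[OF B, of n] by simp
  also have "\<dots> = (\<Sum>i<n. ?B $$ (i, n) * cofactor ?B i n) + ?B $$ (n, n) * cofactor ?B n n"
    by simp
  also have "(\<Sum>i<n. ?B $$ (i, n) * cofactor ?B i n) = 0"
    by (intro sum.neutral) (auto simp: jacobi_mat_def mat_delete_def)
  also have "?B $$ (n, n) = lam n" by (auto simp: jacobi_mat_def mat_delete_def)
  finally have "det ?B = lam n * det (jacobi_mat t b lam n)"
    by (simp add: cofactor_def d2)
  moreover have "det ?M = ?M $$ (Suc n, Suc n) * det (mat_delete ?M (Suc n) (Suc n))
      - ?M $$ (Suc n, n) * det ?B"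
    by (rule det_last_row_two_entries[OF M]) (auto simp: jacobi_mat_def)
  ultimately show ?thesis by (simp add: d1) (simp add: jacobi_mat_def)
qed

text \<open>
  The matrix factors as \<open>A * D * T * A\<^sup>T\<close>, with \<open>A\<close> the unitriangular array, \<open>D\<close> the diagonal of the
  weights and \<open>T\<close> the truncation of \<open>t + J\<close>: the product \<open>A * D * A\<^sup>T\<close> has the moments as entries,
  and \<open>T\<close> turns column \<open>j\<close> of \<open>A\<^sup>T\<close> into \<open>t\<close> times row \<open>j\<close> plus row \<open>j + 1\<close> of the array.
\<close>

lemma det_hankel_shifted_moments:
  fixes b lam :: "nat \<Rightarrow> 'a :: comm_ring_1"
  defines "\<mu> \<equiv> \<lambda>i. stieltjes b lam i 0"
  shows "det (mat n n (\<lambda>(i, j). t * \<mu> (i + j) + \<mu> (Suc (i + j))))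
    = (\<Prod>k<n. jacobi_weight lam k) * det (jacobi_mat t b lam n)"
proof -
  let ?s = "stieltjes b lam"
  let ?w = "jacobi_weight lam"
  define A where "A = mat n n (\<lambda>(i, k). ?s i k)"
  define D where "D = mat n n (\<lambda>(k, l). if k = l then ?w k else 0)"
  let ?T = "jacobi_mat t b lam n"
  have carriers [simp]: "A \<in> carrier_mat n n" "D \<in> carrier_mat n n" "?T \<in> carrier_mat n n"
    by (auto simp: A_def D_def jacobi_mat_def)
  have detA: "det A = 1"
  proof -
    have "det A = prod_list (diag_mat A)"
      by (rule det_lower_triangular[of n]) (auto simp: A_def stieltjes_above_diagonal)
    also have "diag_mat A = map (\<lambda>i. 1) [0..<n]"
      by (auto simp: diag_mat_def A_def stieltjes_diagonal)
    finally show ?thesis by (simp add: map_replicate_const)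
  qed
  have detD: "det D = (\<Prod>k<n. ?w k)"
  proof -
    have "det D = prod_list (diag_mat D)"
      by (rule det_lower_triangular[of n]) (auto simp: D_def)
    also have "diag_mat D = map ?w [0..<n]" by (auto simp: diag_mat_def D_def)
    finally show ?thesis by (simp add: prod.list_conv_set_nth atLeast0LessThan)
  qed
  have TA: "(?T * transpose_mat A) $$ (k, j) = t * ?s j k + ?s (Suc j) k"
    if "k < n" "j < n" for k j
  proof -
    have "(?T * transpose_mat A) $$ (k, j) = (\<Sum>l<n. ?T $$ (k, l) * ?s j l)"
      using that by (auto simp: A_def scalar_prod_def atLeast0LessThan jacobi_mat_def intro!: sum.cong)
    also have "\<dots> = t * ?s j k + ?s (Suc j) k"
      using that by (subst jacobi_mat_mult) (auto simp: stieltjes_above_diagonal)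
    finally show ?thesis .
  qed
  have AD: "(A * D) $$ (i, k) = ?s i k * ?w k" if "i < n" "k < n" for i k
    using that by (simp add: A_def D_def scalar_prod_def if_distrib sum.delta cong: if_cong)
  have "mat n n (\<lambda>(i, j). t * \<mu> (i + j) + \<mu> (Suc (i + j))) = (A * D) * (?T * transpose_mat A)"
    (is "?H = ?R")
  proof (rule eq_matI)
    fix i j assume "i < dim_row ?R" "j < dim_col ?R"
    then have ij: "i < n" "j < n" by (simp_all add: A_def)
    have atM: "{0..<n} = {..n - 1}" using ij by auto
    have "?R $$ (i, j) = (\<Sum>k=0..<n. (A * D) $$ (i, k) * (?T * transpose_mat A) $$ (k, j))"
      using ij by (subst times_mat_def) (simp add: A_def D_def jacobi_mat_def scalar_prod_def)
    also have "\<dots> = (\<Sum>k=0..<n. ?s i k * ?w k * (t * ?s j k + ?s (Suc j) k))"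
      using ij by (intro sum.cong) (simp_all only: AD TA atLeastLessThan_iff)
    also have "\<dots> = t * (\<Sum>k\<le>n - 1. ?w k * ?s i k * ?s j k)
        + (\<Sum>k\<le>n - 1. ?w k * ?s i k * ?s (Suc j) k)"
      unfolding atM sum_distrib_left sum.distrib[symmetric]
      by (intro sum.cong) (simp_all add: algebra_simps)
    also have "\<dots> = t * ?s (i + j) 0 + ?s (i + Suc j) 0"
      using ij by (simp only: stieltjes_gram[of i "n - 1"] less_imp_le_nat Suc_le_eq)
    finally show "?H $$ (i, j) = ?R $$ (i, j)" using ij by (simp add: \<mu>_def)
  qed (auto simp: A_def)
  moreover have "det ?R = det A * det D * (det ?T * det (transpose_mat A))"
    by (simp only: det_mult[of _ n] mult_carrier_mat[of _ n n] transpose_carrier_mat carriers)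
  ultimately show ?thesis by (simp add: det_transpose[of A n] detA detD)
qed

section \<open>Generalized Catalan numbers as moments\<close>

text \<open>
  The coefficient of \<open>L ^ j\<close> in entry \<open>(m + 1, k)\<close> of the array. It comes from the reflection
  principle. Without the boundary at \<open>0\<close>, one step of \<open>J\<close> multiplies a Laurent series in \<open>y\<close> by
  \<open>(1 + y) * (1 + L / y)\<close>, which is invariant under \<open>y \<mapsto> L / y\<close>. The exceptional corner entry \<open>L\<close>
  instead of \<open>L + 1\<close> demands that the coefficients at \<open>-1\<close> and \<open>0\<close> cancel, which holds for the
  initial series \<open>(y - L / y) / (1 + y)\<close>, expanded in powers of \<open>1 / y\<close>: its product with \<open>1 + y\<close> is
  antisymmetric. So entry \<open>(n, k)\<close> with \<open>n \<ge> 1\<close> is the coefficient of \<open>y ^ k\<close> in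
  \<open>(y - L / y) * (1 + y) ^ (n - 1) * (1 + L / y) ^ n\<close>; Pascal's rule gives the form below.
  Row \<open>0\<close> does not fit this pattern, hence the shift of the row index.
\<close>

definition narayana_coeff :: "nat \<Rightarrow> nat \<Rightarrow> nat \<Rightarrow> real" where
  "narayana_coeff m k j = real (Suc m choose (k + j)) * real (Suc m choose j)
     - real (m choose (k + j)) * real (Suc (Suc m) choose j)"

abbreviation narayana_array :: "real \<Rightarrow> nat \<Rightarrow> nat \<Rightarrow> real" where
  "narayana_array L \<equiv> stieltjes (\<lambda>k. if k = 0 then L else L + 1) (\<lambda>_. L)"

lemma narayana_coeff_eq_0: "m + 1 < j \<Longrightarrow> narayana_coeff m k j = 0"
  by (simp add: narayana_coeff_def binomial_eq_0)

text \<open>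
  These are the coefficients of the tridiagonal recurrence. At \<open>k = 0\<close> the two terms of the previous
  row with unchanged \<open>j\<close> are missing: one has no entry to come from, the other is what the
  corner entry \<open>L\<close> lacks compared with \<open>L + 1\<close>.
\<close>

lemma narayana_coeff_rec:
  "narayana_coeff (Suc m) 0 0 = 0"
  "narayana_coeff (Suc m) 0 (Suc j) = narayana_coeff m 0 j + narayana_coeff m 1 j"
  "narayana_coeff (Suc m) (Suc k) 0 = narayana_coeff m k 0 + narayana_coeff m (Suc k) 0"
  "narayana_coeff (Suc m) (Suc k) (Suc j) = narayana_coeff m k (Suc j)
     + narayana_coeff m (Suc k) (Suc j) + narayana_coeff m (Suc k) j
     + narayana_coeff m (Suc (Suc k)) j"
  by (simp_all add: narayana_coeff_def algebra_simps)

lemma narayana_array_explicit: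
  "narayana_array L (Suc m) k = (\<Sum>j\<le>Suc m. narayana_coeff m k j * L ^ j)"
proof (induction m arbitrary: k)
  case 0
  consider "k = 0" | "k = 1" | "k \<ge> 2" by linarith
  then show ?case
    by cases (auto simp: jacobi_def narayana_coeff_def split: nat.splits)
next
  case (Suc m)
  define S where "S k = (\<Sum>j\<le>Suc m. narayana_coeff m k j * L ^ j)" for k
  have S': "S k = narayana_coeff m k 0 + L * (\<Sum>j\<le>Suc m. narayana_coeff m k (Suc j) * L ^ j)" for k
  proof -
    have "S k = (\<Sum>j\<le>Suc (Suc m). narayana_coeff m k j * L ^ j)"
      by (simp add: S_def narayana_coeff_eq_0)
    also have "\<dots> = narayana_coeff m k 0 + L * (\<Sum>j\<le>Suc m. narayana_coeff m k (Suc j) * L ^ j)"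
      by (subst sum.atMost_Suc_shift) (simp add: sum_distrib_left mult_ac del: sum.atMost_Suc)
    finally show ?thesis .
  qed
  have top: "(\<Sum>j\<le>Suc (Suc m). narayana_coeff (Suc m) k j * L ^ j) = narayana_coeff (Suc m) k 0
      + L * (\<Sum>j\<le>Suc m. narayana_coeff (Suc m) k (Suc j) * L ^ j)"
    by (subst sum.atMost_Suc_shift) (simp add: sum_distrib_left mult_ac del: sum.atMost_Suc)
  have "narayana_array L (Suc (Suc m)) k = jacobi (\<lambda>k. if k = 0 then L else L + 1) (\<lambda>_. L) S k"
  proof -
    have "narayana_array L (Suc m) = S" by (intro ext) (simp only: Suc S_def)
    then show ?thesis by (subst stieltjes.simps(2)) (simp only:)
  qed
  also have "\<dots> = (\<Sum>j\<le>Suc (Suc m). narayana_coeff (Suc m) k j * L ^ j)"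
  proof (cases k)
    case 0
    have "L * S 0 + L * S 1 = L * (\<Sum>j\<le>Suc m. narayana_coeff (Suc m) 0 (Suc j) * L ^ j)"
      unfolding S_def narayana_coeff_rec distrib_right sum.distrib distrib_left ..
    with 0 show ?thesis unfolding top by (simp add: jacobi_def narayana_coeff_rec)
  next
    case (Suc l)
    have "S l + (L + 1) * S (Suc l) + L * S (Suc (Suc l))
        = S l + S (Suc l) + L * S (Suc l) + L * S (Suc (Suc l))"
      by (simp add: algebra_simps)
    also have "\<dots> = narayana_coeff (Suc m) k 0
        + L * (\<Sum>j\<le>Suc m. narayana_coeff (Suc m) k (Suc j) * L ^ j)"
    proof -
      have "S l + S (Suc l) = narayana_coeff (Suc m) k 0
          + L * (\<Sum>j\<le>Suc m. (narayana_coeff m l (Suc j) + narayana_coeff m (Suc l) (Suc j)) * L ^ j)"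
        unfolding S' Suc narayana_coeff_rec by (simp only: distrib_right distrib_left sum.distrib add_ac)
      moreover have "L * S (Suc l) + L * S (Suc (Suc l))
          = L * (\<Sum>j\<le>Suc m. (narayana_coeff m (Suc l) j + narayana_coeff m (Suc (Suc l)) j) * L ^ j)"
        unfolding S_def by (simp only: distrib_right distrib_left sum.distrib)
      ultimately show ?thesis
        unfolding Suc narayana_coeff_rec
        by (simp only: distrib_right distrib_left sum.distrib add_ac)
    qed
    finally show ?thesis unfolding top using Suc by (simp add: jacobi_def)
  qed
  finally show ?case .
qed

text \<open>
  At \<open>k = 0\<close> the two products of binomials in the explicit entry are exactly the summands of the two
  generalized Pascal numbers whose difference is the generalized Catalan number.
\<close>

lemma gen_catalan_eq_moment: "gen_catalan n L = narayana_array L n 0"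
proof (cases n)
  case 0
  then show ?thesis by (simp add: gen_catalan_def)
next
  case (Suc m)
  have d: "2 * n - n = Suc m" "2 * n - m = Suc (Suc m)" "n - 1 = m" using Suc by auto
  \<comment> \<open>The top summand, \<open>j = m + 2\<close>, vanishes, so that both sums can be taken over \<open>j \<le> m + 1\<close>.\<close>
  have "gen_pascal (2 * n) (n - 1) L
      = (\<Sum>j\<le>Suc m. real (m choose j) * real (Suc (Suc m) choose j) * L ^ j)"
    unfolding gen_pascal_def d by (simp add: atLeast0AtMost binomial_eq_0)
  moreover have "gen_pascal (2 * n) n L
      = (\<Sum>j\<le>Suc m. real (Suc m choose j) * real (Suc m choose j) * L ^ j)"
    unfolding gen_pascal_def d by (simp only: Suc atLeast0AtMost)
  ultimately show ?thesis
    unfolding Suc narayana_array_explicit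
    by (simp only: gen_catalan_def Suc narayana_coeff_def sum_subtractf[symmetric]
        left_diff_distrib add_0 nat.simps if_False)
qed

section \<open>The Hankel transform\<close>

text \<open>
  Both sides satisfy the same second-order recurrence: clearing the powers of \<open>2\<close> turns the
  continuant recurrence into one with characteristic polynomial \<open>x\<^sup>2 - 2 * (L + 2) * x + 4 * L\<close>, whose
  roots are \<open>L + 2 \<plusminus> s\<close>.
\<close>

lemma det_jacobi_mat_narayana:
  fixes L :: real
  defines "s \<equiv> sqrt (L\<^sup>2 + 4)"
  shows "det (jacobi_mat 1 (\<lambda>k. if k = 0 then L else L + 1) (\<lambda>_. L) n)
    = ((s + L) * (s + L + 2) ^ n + (s - L) * (L + 2 - s) ^ n) / (2 ^ (n + 1) * s)"
proof -
  let ?d = "\<lambda>n. det (jacobi_mat 1 (\<lambda>k. if k = 0 then L else L + 1) (\<lambda>_. L) n)"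
  have pos: "L\<^sup>2 + 4 > 0" by (simp add: add_nonneg_pos)
  then have s: "s > 0" and s2: "s * s = L * L + 4"
    by (simp_all add: s_def power2_eq_square[symmetric])
  have "?d n * (2 ^ (n + 1) * s) = (s + L) * (s + L + 2) ^ n + (s - L) * (L + 2 - s) ^ n"
  proof (induction n rule: induct_nat_012)
    case 0
    have "?d 0 = 1" by (simp add: jacobi_mat_def)
    then show ?case by simp
  next
    case 1
    have "?d 1 = L + 1" by (simp add: jacobi_mat_def det_single)
    with s2 show ?case by (simp add: algebra_simps)
  next
    case (ge2 n)
    have root: "x ^ 2 = 2 * (L + 2) * x - 4 * L" if "x = s + L + 2 \<or> x = L + 2 - s" for x
      using that
    proof
      assume x: "x = s + L + 2"
      show ?thesis using s2 unfolding x by (simp add: power2_eq_square algebra_simps)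
    next
      assume x: "x = L + 2 - s"
      show ?thesis using s2 unfolding x by (simp add: power2_eq_square algebra_simps)
    qed
    have pow: "x ^ Suc (Suc n) = 2 * (L + 2) * x ^ Suc n - 4 * L * x ^ n"
      if "x = s + L + 2 \<or> x = L + 2 - s" for x
    proof -
      have "x ^ Suc (Suc n) = x ^ 2 * x ^ n" by (simp add: power2_eq_square)
      then show ?thesis unfolding root[OF that] by (simp add: algebra_simps)
    qed
    have "?d (Suc (Suc n)) * (2 ^ (Suc (Suc n) + 1) * s)
        = 2 * (L + 2) * (?d (Suc n) * (2 ^ (Suc n + 1) * s)) - 4 * L * (?d n * (2 ^ (n + 1) * s))"
      by (simp add: det_jacobi_mat_rec algebra_simps)
    also have "\<dots> = (s + L) * (2 * (L + 2) * (s + L + 2) ^ Suc n - 4 * L * (s + L + 2) ^ n)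
        + (s - L) * (2 * (L + 2) * (L + 2 - s) ^ Suc n - 4 * L * (L + 2 - s) ^ n)"
      unfolding ge2 by (simp only: algebra_simps)
    also have "\<dots> = (s + L) * (s + L + 2) ^ Suc (Suc n) + (s - L) * (L + 2 - s) ^ Suc (Suc n)"
      by (simp only: pow simp_thms)
    finally show ?case .
  qed
  with s show ?thesis by (simp add: field_simps)
qed

theorem theorem1p1:
  fixes L :: real and n :: nat
  assumes "n \<ge> 1"
  shows "hankel_transform (catalan_sum L) n =
    L ^ ((n\<^sup>2 - n) div 2) / (2 ^ (n + 1) * sqrt (L\<^sup>2 + 4)) *
      ((sqrt (L\<^sup>2 + 4) + L) * (sqrt (L\<^sup>2 + 4) + L + 2) ^ n
       + (sqrt (L\<^sup>2 + 4) - L) * (L + 2 - sqrt (L\<^sup>2 + 4)) ^ n)"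
proof -
  \<comment> \<open>The exceptional value \<open>L + 1\<close> at index \<open>0\<close> agrees with \<open>c(0; L) + c(1; L)\<close>.\<close>
  have a: "catalan_sum L i = narayana_array L i 0 + narayana_array L (Suc i) 0" for i
    by (cases i) (simp_all add: catalan_sum_def gen_catalan_eq_moment jacobi_def)
  have "(\<Prod>k<n. jacobi_weight (\<lambda>_. L) k) = L ^ (\<Sum>k<n. k)"
    by (simp add: jacobi_weight_def power_sum)
  also have "(\<Sum>k<n. k) = (n\<^sup>2 - n) div 2"
    by (cases n) (simp_all add: lessThan_Suc_atMost atLeast0AtMost[symmetric] gauss_sum_nat
        power2_eq_square)
  finally have w: "(\<Prod>k<n. jacobi_weight (\<lambda>_. L) k) = L ^ ((n\<^sup>2 - n) div 2)" .
  show ?thesis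
    unfolding hankel_transform_def a
    using det_hankel_shifted_moments[of n 1 "\<lambda>k. if k = 0 then L else L + 1" "\<lambda>_. L"]
    by (simp add: w det_jacobi_mat_narayana)
qed

end
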